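(* Let $(Y_n)_{n\ge 0}$ be a sequence of $\{0,1\}$-valued random variables with $Y_0=0$ and, for every $n\ge 1$, the conditional distribution of $Y_n$ given $Y_0,\dots,Y_{n-1}$ is Bernoulli with success probability $$\frac{1}{1+\sum_{j=0}^{n-1}Y_j}.$$ Let $Z_n=\sum_{i=0}^{n}Y_i$ for $n\ge 0$. Let $\{X_n\}_{n\ge 0}$ be the homogeneous discrete-time Markov chain on $\{0,1,2,\dots\}$ with $X_0=0$ and transition probabilities $$P(X_{n+1}=i+1\mid X_n=i)=\frac{1}{1+i},\qquad P(X_{n+1}=i\mid X_n=i)=\frac{i}{1+i}.$$ Then for every $n\ge 0$, $Z_n$ and $X_n$ have the same distribution.
   Context: All transition probabilities of the chain not listed are zero. *)

theory Defs
  imports "HOL-Probability.Probability"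
begin

text \<open>
  Conditional probabilities are the elementary ones of the library
  (\<^const>\<open>cond_prob\<close>), so they carry information only when the conditioning event has
  positive probability; hence the positivity guards below.
\<close>

definition conditionally_bernoulli :: "'a measure \<Rightarrow> ('a \<Rightarrow> nat) \<Rightarrow> ('a \<Rightarrow> bool) \<Rightarrow> real \<Rightarrow> bool" where
  "conditionally_bernoulli M V E p \<longleftrightarrow>
     (\<forall>k. \<P>(\<omega> in M. V \<omega> = k \<bar> E \<omega>) = pmf (map_pmf of_bool (bernoulli_pmf p)) k)"

text \<open>
  The event \<open>\<forall>i\<le>n. X i \<omega> = x i\<close> depends only on the values \<open>x 0, \<dots>, x n\<close> of \<open>x\<close>.
\<close>

definition markov_property :: "'a measure \<Rightarrow> (nat \<Rightarrow> 'a \<Rightarrow> 's::countable) \<Rightarrow> bool" where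
  "markov_property N X \<longleftrightarrow>
     (\<forall>n x j. \<P>(\<omega> in N. \<forall>i\<le>n. X i \<omega> = x i) > 0 \<longrightarrow>
        \<P>(\<omega> in N. X (Suc n) \<omega> = j \<bar> \<forall>i\<le>n. X i \<omega> = x i) =
        \<P>(\<omega> in N. X (Suc n) \<omega> = j \<bar> X n \<omega> = x n))"

text \<open>Homogeneity: the one-step transition probabilities \<open>p\<close> do not depend on the time \<open>n\<close>.\<close>

definition homogeneous_markov_chain ::
    "'a measure \<Rightarrow> (nat \<Rightarrow> 'a \<Rightarrow> 's::countable) \<Rightarrow> ('s \<Rightarrow> 's \<Rightarrow> real) \<Rightarrow> bool" where
  "homogeneous_markov_chain N X p \<longleftrightarrow>
     (\<forall>n. X n \<in> measurable N (count_space UNIV)) \<and>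
     markov_property N X \<and>
     (\<forall>n i j. \<P>(\<omega> in N. X n \<omega> = i) > 0 \<longrightarrow>
        \<P>(\<omega> in N. X (Suc n) \<omega> = j \<bar> X n \<omega> = i) = p i j)"

definition step_prob :: "nat \<Rightarrow> nat \<Rightarrow> real" where
  "step_prob i j =
     (if j = i + 1 then 1 / (1 + real i)
      else if j = i then real i / (1 + real i)
      else 0)"

end

theory Submission
  imports Defs
begin

text \<open>
  A sequence with values in the natural numbers whose consecutive values satisfy
  \<open>P(S\<^sub>n = i, S\<^sub>n\<^sub>+\<^sub>1 = j) = P(S\<^sub>n = i) p(i, j)\<close> has one-dimensional laws that obey the recursion
  \<open>P(S\<^sub>n\<^sub>+\<^sub>1 = j) = \<Sum>\<^sub>i P(S\<^sub>n = i) p(i, j)\<close>, so they are determined by the law of \<open>S\<^sub>0\<close>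
  (lemma \<open>same_laws_if_same_transitions\<close>). It remains to see that both processes satisfy this
  with \<open>p = step_prob\<close>. For the chain it is the definition of the transition probabilities. For
  the partial sums (lemma \<open>partial_sum_transition\<close>) the point is that the success probability of
  \<open>Y\<^sub>n\<^sub>+\<^sub>1\<close> depends on the history \<open>Y\<^sub>0, \<dots>, Y\<^sub>n\<close> only through its sum. Since \<open>{Z\<^sub>n = i}\<close> is a
  finite disjoint union of histories with sum \<open>i\<close>, each of which is followed by a success with
  the same probability \<open>1 / (1 + i)\<close>, this is also the probability given \<open>Z\<^sub>n = i\<close> itself.
\<close>

text \<open>
  The joint form of a conditional probability: unlike the quotient, it also holds when the
  conditioning event is null.
\<close>

lemma joint_prob_of_cond_prob:
  assumes "prob_space M"
    and E: "{\<omega> \<in> space M. E \<omega>} \<in> sets M"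
    and cond: "\<P>(\<omega> in M. E \<omega>) > 0 \<Longrightarrow> \<P>(\<omega> in M. A \<omega> \<bar> E \<omega>) = c"
  shows "\<P>(\<omega> in M. E \<omega> \<and> A \<omega>) = \<P>(\<omega> in M. E \<omega>) * c"
proof -
  interpret prob_space M by fact
  show ?thesis
  proof (cases "\<P>(\<omega> in M. E \<omega>) > 0")
    case True
    then show ?thesis
      using cond by (simp add: cond_prob_def field_simps conj_commute)
  next
    case False
    then have null: "\<P>(\<omega> in M. E \<omega>) = 0"
      using measure_nonneg[of M "{\<omega> \<in> space M. E \<omega>}"] by linarith
    have "\<P>(\<omega> in M. E \<omega> \<and> A \<omega>) \<le> \<P>(\<omega> in M. E \<omega>)"
      by (rule finite_measure_mono[OF _ E]) auto
    then show ?thesis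
      using null measure_nonneg[of M "{\<omega> \<in> space M. E \<omega> \<and> A \<omega>}"] by simp
  qed
qed

lemma marginal_sums:
  fixes U V :: "'a \<Rightarrow> nat"
  assumes "prob_space M"
    and [measurable]: "U \<in> measurable M (count_space UNIV)" "V \<in> measurable M (count_space UNIV)"
  shows "(\<lambda>i. \<P>(\<omega> in M. U \<omega> = i \<and> V \<omega> = j)) sums \<P>(\<omega> in M. V \<omega> = j)"
proof -
  interpret prob_space M by fact
  show ?thesis by (rule prob_sums) auto
qed

text \<open>
  Summing the joint laws of consecutive values over the earlier one gives the same linear
  recursion for both sequences of marginals. The hypotheses are stated with joint
  probabilities so that no state has to be checked for positive probability.
\<close>

lemma same_laws_if_same_transitions:
  fixes S :: "nat \<Rightarrow> 'a \<Rightarrow> nat" and T :: "nat \<Rightarrow> 'b \<Rightarrow> nat"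
  assumes M: "prob_space M" and N: "prob_space N"
    and S: "\<And>n. S n \<in> measurable M (count_space UNIV)"
    and T: "\<And>n. T n \<in> measurable N (count_space UNIV)"
    and init: "\<And>i. \<P>(\<omega> in M. S 0 \<omega> = i) = \<P>(\<omega> in N. T 0 \<omega> = i)"
    and trS: "\<And>n i j. \<P>(\<omega> in M. S n \<omega> = i \<and> S (Suc n) \<omega> = j) = \<P>(\<omega> in M. S n \<omega> = i) * p i j"
    and trT: "\<And>n i j. \<P>(\<omega> in N. T n \<omega> = i \<and> T (Suc n) \<omega> = j) = \<P>(\<omega> in N. T n \<omega> = i) * p i j"
  shows "distr M (count_space UNIV) (S n) = distr N (count_space UNIV) (T n)"
proof -
  interpret M: prob_space M by fact
  interpret N: prob_space N by fact
  have point: "\<P>(\<omega> in M. S n \<omega> = i) = \<P>(\<omega> in N. T n \<omega> = i)" for i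
  proof (induction n arbitrary: i)
    case 0
    show ?case by (rule init)
  next
    case (Suc n)
    have "(\<lambda>k. \<P>(\<omega> in N. T n \<omega> = k) * p k i) sums \<P>(\<omega> in M. S (Suc n) \<omega> = i)"
      using marginal_sums[OF M S S, of n "Suc n" i] by (simp only: trS Suc.IH)
    moreover have "(\<lambda>k. \<P>(\<omega> in N. T n \<omega> = k) * p k i) sums \<P>(\<omega> in N. T (Suc n) \<omega> = i)"
      using marginal_sums[OF N T T, of n "Suc n" i] by (simp only: trT)
    ultimately show ?case by (rule sums_unique2)
  qed
  show ?thesis
  proof (rule measure_eqI_countable)
    fix i :: nat
    have "emeasure M (S n -` {i} \<inter> space M) = emeasure N (T n -` {i} \<inter> space N)"
      using point[of i]
      by (simp add: M.emeasure_eq_measure N.emeasure_eq_measure vimage_def Int_def conj_commute)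
    then show "emeasure (distr M (count_space UNIV) (S n)) {i} =
        emeasure (distr N (count_space UNIV) (T n)) {i}"
      using S T by (simp add: emeasure_distr)
  qed auto
qed

lemma pmf_bernoulli_step:
  "pmf (map_pmf of_bool (bernoulli_pmf (1 / (1 + real i)))) k = step_prob i (i + k)"
proof -
  let ?B = "bernoulli_pmf (1 / (1 + real i))"
  have inj: "inj (of_bool :: bool \<Rightarrow> nat)"
    by (auto intro!: injI split: if_splits simp: of_bool_def)
  consider "k = of_bool True" | "k = of_bool False" | "k \<notin> range (of_bool :: bool \<Rightarrow> nat)"
    by (cases "k \<in> range (of_bool :: bool \<Rightarrow> nat)") (auto simp: of_bool_def split: if_splits)
  then show ?thesis
  proof cases
    case 1
    have "pmf (map_pmf of_bool ?B) k = pmf ?B True"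
      unfolding 1 by (rule pmf_map_inj'[OF inj])
    then show ?thesis using 1 by (simp add: step_prob_def)
  next
    case 2
    have "pmf (map_pmf of_bool ?B) k = pmf ?B False"
      unfolding 2 by (rule pmf_map_inj'[OF inj])
    then show ?thesis using 2 by (simp add: step_prob_def field_simps)
  next
    case 3
    then have "pmf (map_pmf of_bool ?B) k = 0"
      by (intro pmf_map_outside) auto
    moreover have "k \<noteq> 0" "k \<noteq> 1"
      using 3 by (auto simp: image_iff of_bool_def split: if_splits)
    ultimately show ?thesis by (simp add: step_prob_def)
  qed
qed

text \<open>
  Lumping: the event \<open>Z\<^sub>n = i\<close> splits into the 0-1 histories with sum \<open>i\<close>, all of which
  have the same conditional law of the next increment.
\<close>

lemma partial_sum_transition:
  fixes Y :: "nat \<Rightarrow> 'a \<Rightarrow> nat"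
  assumes M: "prob_space M"
    and Y: "\<And>n. Y n \<in> measurable M (count_space {0, 1})"
    and bern: "\<And>n y. n \<ge> 1 \<Longrightarrow> \<P>(\<omega> in M. \<forall>j<n. Y j \<omega> = y j) > 0 \<Longrightarrow>
           conditionally_bernoulli M (Y n) (\<lambda>\<omega>. \<forall>j<n. Y j \<omega> = y j)
             (1 / (1 + (\<Sum>j<n. real (y j))))"
  shows "\<P>(\<omega> in M. (\<Sum>l\<le>n. Y l \<omega>) = i \<and> (\<Sum>l\<le>Suc n. Y l \<omega>) = j) =
         \<P>(\<omega> in M. (\<Sum>l\<le>n. Y l \<omega>) = i) * step_prob i j"
proof -
  interpret prob_space M by fact
  have Y_meas [measurable]: "Y m \<in> measurable M (count_space UNIV)" for m
    using measurable_compose[OF Y, of "\<lambda>x. x"] by simp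
  have Y01: "Y m \<omega> \<in> {0, 1}" if "\<omega> \<in> space M" for m \<omega>
    using measurable_space[OF Y that] by simp
  define H where "H = {y \<in> {..<Suc n} \<rightarrow>\<^sub>E {0, 1}. (\<Sum>l<Suc n. y l) = i}"
  have "finite H"
    unfolding H_def by (intro finite_subset[OF _ finite_PiE[of "{..<Suc n}" "\<lambda>_. {0, 1::nat}"]]) auto
  \<comment> \<open>Used for the increment event \<open>A \<omega> \<longleftrightarrow> Y (Suc n) \<omega> = k\<close>, and for the trivial event to sum the
    probabilities of the histories back to that of \<open>Z\<^sub>n = i\<close>.\<close>
  have split: "\<P>(\<omega> in M. (\<Sum>l\<le>n. Y l \<omega>) = i \<and> A \<omega>) =
      (\<Sum>y\<in>H. \<P>(\<omega> in M. (\<forall>l<Suc n. Y l \<omega> = y l) \<and> A \<omega>))"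
    if [measurable]: "Measurable.pred M A" for A
  proof (rule prob_sum[OF \<open>finite H\<close>])
    have "\<exists>!y. y \<in> H \<and> (\<forall>l<Suc n. Y l \<omega> = y l) \<and> A \<omega>"
      if \<omega>: "\<omega> \<in> space M" and sum: "(\<Sum>l\<le>n. Y l \<omega>) = i" and "A \<omega>" for \<omega>
    proof (rule ex1I)
      have "restrict (\<lambda>l. Y l \<omega>) {..<Suc n} \<in> H"
        using Y01[OF \<omega>] sum by (auto simp: H_def lessThan_Suc_atMost)
      then show "restrict (\<lambda>l. Y l \<omega>) {..<Suc n} \<in> H \<and>
          (\<forall>l<Suc n. Y l \<omega> = restrict (\<lambda>l. Y l \<omega>) {..<Suc n} l) \<and> A \<omega>"
        using \<open>A \<omega>\<close> by simp
    next
      fix y assume y: "y \<in> H \<and> (\<forall>l<Suc n. Y l \<omega> = y l) \<and> A \<omega>"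
      then have "y \<in> {..<Suc n} \<rightarrow>\<^sub>E {0, 1}"
        unfolding H_def by blast
      then show "y = restrict (\<lambda>l. Y l \<omega>) {..<Suc n}"
        by (intro extensionalityI[of _ "{..<Suc n}"]) (use y in \<open>simp_all add: PiE_iff\<close>)
    qed
    moreover have "(\<Sum>l\<le>n. Y l \<omega>) = i" if "y \<in> H" "\<forall>l<Suc n. Y l \<omega> = y l" for y \<omega>
      using that by (simp add: H_def flip: lessThan_Suc_atMost del: sum.lessThan_Suc)
    ultimately show "AE \<omega> in M. (\<forall>y\<in>H. (\<forall>l<Suc n. Y l \<omega> = y l) \<and> A \<omega> \<longrightarrow>
          (\<Sum>l\<le>n. Y l \<omega>) = i \<and> A \<omega>) \<and>
        ((\<Sum>l\<le>n. Y l \<omega>) = i \<and> A \<omega> \<longrightarrow> (\<exists>!y\<in>H. (\<forall>l<Suc n. Y l \<omega> = y l) \<and> A \<omega>))"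
      by (intro AE_I2) blast
  qed auto
  show ?thesis
  proof (cases "j < i")
    case True
    then have "{\<omega> \<in> space M. (\<Sum>l\<le>n. Y l \<omega>) = i \<and> (\<Sum>l\<le>Suc n. Y l \<omega>) = j} = {}"
      by auto
    then show ?thesis
      using True by (simp only: measure_empty) (simp add: step_prob_def)
  next
    case False
    then obtain k where k: "j = i + k"
      using le_Suc_ex[of i j] by auto
    have history: "\<P>(\<omega> in M. (\<forall>l<Suc n. Y l \<omega> = y l) \<and> Y (Suc n) \<omega> = k) =
        \<P>(\<omega> in M. \<forall>l<Suc n. Y l \<omega> = y l) * step_prob i j" if "y \<in> H" for y
    proof (rule joint_prob_of_cond_prob[OF M])
      assume "\<P>(\<omega> in M. \<forall>l<Suc n. Y l \<omega> = y l) > 0"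
      then have "conditionally_bernoulli M (Y (Suc n)) (\<lambda>\<omega>. \<forall>l<Suc n. Y l \<omega> = y l)
          (1 / (1 + (\<Sum>l<Suc n. real (y l))))"
        by (intro bern) auto
      moreover have "(\<Sum>l<Suc n. real (y l)) = real i"
        using that unfolding H_def of_nat_sum[symmetric] by simp
      ultimately show "\<P>(\<omega> in M. Y (Suc n) \<omega> = k \<bar> \<forall>l<Suc n. Y l \<omega> = y l) = step_prob i j"
        by (simp add: conditionally_bernoulli_def pmf_bernoulli_step k del: sum.lessThan_Suc)
    qed auto
    have "\<P>(\<omega> in M. (\<Sum>l\<le>n. Y l \<omega>) = i \<and> (\<Sum>l\<le>Suc n. Y l \<omega>) = j) =
        \<P>(\<omega> in M. (\<Sum>l\<le>n. Y l \<omega>) = i \<and> Y (Suc n) \<omega> = k)"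
      by (rule arg_cong[where f = "measure M"]) (auto simp: k)
    also have "\<dots> = (\<Sum>y\<in>H. \<P>(\<omega> in M. (\<forall>l<Suc n. Y l \<omega> = y l) \<and> Y (Suc n) \<omega> = k))"
      by (rule split) simp
    also have "\<dots> = (\<Sum>y\<in>H. \<P>(\<omega> in M. \<forall>l<Suc n. Y l \<omega> = y l)) * step_prob i j"
      by (simp only: history sum_distrib_right cong: sum.cong)
    also have "(\<Sum>y\<in>H. \<P>(\<omega> in M. \<forall>l<Suc n. Y l \<omega> = y l)) = \<P>(\<omega> in M. (\<Sum>l\<le>n. Y l \<omega>) = i)"
      using split[of "\<lambda>_. True"] by simp
    finally show ?thesis .
  qed
qed

lemma chain_transition:
  fixes X :: "nat \<Rightarrow> 'b \<Rightarrow> 's::countable"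
  assumes "prob_space N" and chain: "homogeneous_markov_chain N X p"
  shows "\<P>(\<omega> in N. X n \<omega> = i \<and> X (Suc n) \<omega> = j) = \<P>(\<omega> in N. X n \<omega> = i) * p i j"
proof (rule joint_prob_of_cond_prob[OF assms(1)])
  have [measurable]: "X n \<in> measurable N (count_space UNIV)"
    using chain by (simp add: homogeneous_markov_chain_def)
  show "{\<omega> \<in> space N. X n \<omega> = i} \<in> sets N" by simp
qed (use chain in \<open>simp add: homogeneous_markov_chain_def\<close>)

lemma AE_const_point_prob:
  assumes "prob_space M" and [measurable]: "V \<in> measurable M (count_space UNIV)"
    and "AE \<omega> in M. V \<omega> = c"
  shows "\<P>(\<omega> in M. V \<omega> = i) = of_bool (i = c)"
proof -
  interpret prob_space M by fact
  have "\<P>(\<omega> in M. V \<omega> = i) = \<P>(\<omega> in M. i = c)"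
    using assms(3) by (intro prob_eq_AE) auto
  then show ?thesis
    by (cases "i = c") (auto simp: prob_space)
qed

theorem proposition2p3:
  fixes M :: "'a measure" and N :: "'b measure"
    and Y :: "nat \<Rightarrow> 'a \<Rightarrow> nat" and X :: "nat \<Rightarrow> 'b \<Rightarrow> nat"
  assumes "prob_space M"
    and "\<And>n. Y n \<in> measurable M (count_space {0, 1})"
    and "AE \<omega> in M. Y 0 \<omega> = 0"
    and "\<And>n y. n \<ge> 1 \<Longrightarrow> \<P>(\<omega> in M. \<forall>j<n. Y j \<omega> = y j) > 0 \<Longrightarrow>
           conditionally_bernoulli M (Y n) (\<lambda>\<omega>. \<forall>j<n. Y j \<omega> = y j)
             (1 / (1 + (\<Sum>j<n. real (y j))))"
    and "prob_space N"
    and "homogeneous_markov_chain N X step_prob"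
    and "AE \<omega> in N. X 0 \<omega> = 0"
  shows "\<forall>n. distr M (count_space UNIV) (\<lambda>\<omega>. \<Sum>i\<le>n. Y i \<omega>) =
             distr N (count_space UNIV) (X n)"
proof
  fix n
  have Y: "Y m \<in> measurable M (count_space UNIV)" for m
    using measurable_compose[OF assms(2), of "\<lambda>x. x"] by simp
  have X: "X m \<in> measurable N (count_space UNIV)" for m
    using assms(6) by (simp add: homogeneous_markov_chain_def)
  show "distr M (count_space UNIV) (\<lambda>\<omega>. \<Sum>i\<le>n. Y i \<omega>) = distr N (count_space UNIV) (X n)"
  proof (rule same_laws_if_same_transitions[OF assms(1,5) _ X, where p = step_prob])
    show "(\<lambda>\<omega>. \<Sum>i\<le>m. Y i \<omega>) \<in> measurable M (count_space UNIV)" for m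
      using Y by measurable
    show "\<P>(\<omega> in M. (\<Sum>i\<le>0. Y i \<omega>) = k) = \<P>(\<omega> in N. X 0 \<omega> = k)" for k
      using AE_const_point_prob[OF assms(1) Y assms(3)]
        AE_const_point_prob[OF assms(5) X assms(7)] by simp
  qed (rule partial_sum_transition[OF assms(1,2,4)] chain_transition[OF assms(5,6)]; assumption)+
qed

end
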